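(* Let $\mathrm{H}:\mathbf{Top}_0\to\mathbf{Set}$ be an R-subset system having property M and let $X$ be a $T_0$ space. Then the following conditions are equivalent: (1) $X$ is super $\mathrm{H}$-sober. (2) $P_S(X)$ is super $\mathrm{H}$-sober.
   Context: $\mathbf{Top}_0$ is the category of all $T_0$ spaces with continuous mappings. A subset $A$ of a space $X$ is irreducible if it is nonempty and whenever $A\subseteq F_1\cup F_2$ with $F_1,F_2$ closed in $X$, then $A\subseteq F_1$ or $A\subseteq F_2$. An R-subset system (irreducible subset system) is a covariant functor $\mathrm{H}:\mathbf{Top}_0\to\mathbf{Set}$ such that (i) for every $T_0$ space $X$, $\mathrm{H}(X)$ is a set of irreducible subsets of $X$ which contains all singletons $\{x\}$, $x\in X$; (ii) for every continuous mapping $f:X\to Y$ between $T_0$ spaces and every $A\in \mathrm{H}(X)$, $\mathrm{H}(f)(A)=f(A)\in \mathrm{H}(Y)$. A $T_0$ space $X$ is $\mathrm{H}$-sober if for every $A\in\mathrm{H}(X)$ there is a (necessarily unique) point $x\in X$ with $\overline{A}=\overline{\{x\}}$. The specialization order of a $T_0$ space $X$ is $x\le y$ iff $x\in\overline{\{y\}}$; $\mathord{\uparrow}A$ is the upper closure of $A$ in this order. A subset is saturated if it is an intersection of open sets (equivalently, an upper set). $\mathsf{K}(X)$ is the set of all nonempty compact saturated subsets of $X$. The Smyth power space $P_S(X)$ is $\mathsf{K}(X)$ with the topology having as base the sets $\Box U=\{K\in\mathsf{K}(X):K\subseteq U\}$, $U$ open in $X$ (it is a $T_0$ space). A $T_0$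 space $X$ is super $\mathrm{H}$-sober if $P_S(X)$ is $\mathrm{H}$-sober. $\mathrm{H}$ has property M if for every $T_0$ space $X$, every $\mathcal K\in\mathrm{H}(P_S(X))$ and every closed $A\subseteq X$ with $K\cap A\neq\emptyset$ for all $K\in\mathcal K$, one has $\{\mathord{\uparrow}(K\cap A):K\in\mathcal K\}\in\mathrm{H}(P_S(X))$. *)

theory Defs
  imports "HOL-Analysis.Analysis"
begin

section \<open>Irreducible sets, specialization order, Smyth power space\<close>

definition irreducible_in :: "'a topology \<Rightarrow> 'a set \<Rightarrow> bool" where
  "irreducible_in X A \<longleftrightarrow>
     A \<subseteq> topspace X \<and> A \<noteq> {} \<and>
     (\<forall>F1 F2. closedin X F1 \<and> closedin X F2 \<and> A \<subseteq> F1 \<union> F2 \<longrightarrow> A \<subseteq> F1 \<or> A \<subseteq> F2)"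

definition spec_le :: "'a topology \<Rightarrow> 'a \<Rightarrow> 'a \<Rightarrow> bool" where
  "spec_le X x y \<longleftrightarrow> x \<in> topspace X \<and> y \<in> topspace X \<and> x \<in> X closure_of {y}"

definition up_closure :: "'a topology \<Rightarrow> 'a set \<Rightarrow> 'a set" where
  "up_closure X A = {y. \<exists>x\<in>A. spec_le X x y}"

text \<open>The intersection is taken inside the space, so the empty family yields the whole space.\<close>

definition saturated_in :: "'a topology \<Rightarrow> 'a set \<Rightarrow> bool" where
  "saturated_in X A \<longleftrightarrow> (\<exists>\<U>. (\<forall>U\<in>\<U>. openin X U) \<and> A = topspace X \<inter> \<Inter>\<U>)"

definition compact_saturated :: "'a topology \<Rightarrow> 'a set set" where
  "compact_saturated X = {K. K \<noteq> {} \<and> compactin X K \<and> saturated_in X K}"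

definition smyth_box :: "'a topology \<Rightarrow> 'a set \<Rightarrow> 'a set set" where
  "smyth_box X U = {K \<in> compact_saturated X. K \<subseteq> U}"

definition smyth :: "'a topology \<Rightarrow> 'a set topology" where
  "smyth X = topology (arbitrary union_of (\<lambda>\<B>. \<exists>U. openin X U \<and> \<B> = smyth_box X U))"

lemma openin_smyth:
  "openin (smyth X) = arbitrary union_of (\<lambda>\<B>. \<exists>U. openin X U \<and> \<B> = smyth_box X U)"
proof -
  have "istopology (arbitrary union_of (\<lambda>\<B>. \<exists>U. openin X U \<and> \<B> = smyth_box X U))"
  proof (rule istopology_base)
    fix S T
    assume "\<exists>U. openin X U \<and> S = smyth_box X U" "\<exists>U. openin X U \<and> T = smyth_box X U"
    then obtain U V where "openin X U" "openin X V" "S = smyth_box X U" "T = smyth_box X V"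
      by blast
    then have "openin X (U \<inter> V) \<and> S \<inter> T = smyth_box X (U \<inter> V)"
      by (auto simp: smyth_box_def)
    then show "\<exists>U. openin X U \<and> S \<inter> T = smyth_box X U"
      by blast
  qed
  then show ?thesis
    by (simp add: smyth_def)
qed

lemma openin_smyth_box: "openin X U \<Longrightarrow> openin (smyth X) (smyth_box X U)"
  unfolding openin_smyth by (rule union_of_inc) (auto simp: arbitrary_def)

lemma topspace_smyth: "topspace (smyth X) = compact_saturated X"
proof
  show "topspace (smyth X) \<subseteq> compact_saturated X"
    using openin_topspace [of "smyth X"]
    unfolding openin_smyth union_of_def smyth_box_def by fastforce
  have "compact_saturated X = smyth_box X (topspace X)"
    by (auto simp: smyth_box_def compact_saturated_def dest: compactin_subset_topspace)
  then show "compact_saturated X \<subseteq> topspace (smyth X)"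
    by (metis openin_smyth_box openin_subset openin_topspace)
qed

lemma t0_space_smyth: "t0_space (smyth X)"
  unfolding t0_space_def
proof (intro ballI impI)
  fix K L
  assume K: "K \<in> topspace (smyth X)" and L: "L \<in> topspace (smyth X)" and "K \<noteq> L"
  have sep: "\<exists>\<W>. openin (smyth X) \<W> \<and> P \<in> \<W> \<and> Q \<notin> \<W>"
    if P: "P \<in> topspace (smyth X)" and Q: "Q \<in> topspace (smyth X)" and "\<not> Q \<subseteq> P" for P Q
  proof -
    obtain \<U> where \<U>: "\<forall>U\<in>\<U>. openin X U" "P = topspace X \<inter> \<Inter>\<U>"
      using P by (auto simp: topspace_smyth compact_saturated_def saturated_in_def)
    have "Q \<subseteq> topspace X"
      using Q by (auto simp: topspace_smyth compact_saturated_def dest: compactin_subset_topspace)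
    then obtain U where "U \<in> \<U>" "\<not> Q \<subseteq> U"
      using \<U> \<open>\<not> Q \<subseteq> P\<close> by blast
    then have "openin (smyth X) (smyth_box X U)" "P \<in> smyth_box X U" "Q \<notin> smyth_box X U"
      using \<U> P openin_smyth_box by (auto simp: smyth_box_def topspace_smyth)
    then show ?thesis by blast
  qed
  show "\<exists>U. openin (smyth X) U \<and> (K \<notin> U \<longleftrightarrow> L \<in> U)"
    using sep [OF K L] sep [OF L K] \<open>K \<noteq> L\<close> by blast
qed


section \<open>R-subset systems\<close>

text \<open>
  The category of \<open>T\<^sub>0\<close> spaces is taken relative to a universe: its objects are the \<open>T\<^sub>0\<close> topologies
  whose points lie in the type \<open>'u\<close>, an arbitrary type which every statement is universally
  quantified over.  A subset system is given by its object part \<open>H\<close> alone, since the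
  action on a morphism \<open>f\<close> is prescribed to be \<open>A \<mapsto> f ` A\<close>; the functor laws
  are then automatic.
\<close>

definition R_subset_system :: "('u topology \<Rightarrow> 'u set set) \<Rightarrow> bool" where
  "R_subset_system H \<longleftrightarrow>
     (\<forall>X. t0_space X \<longrightarrow>
        (\<forall>A \<in> H X. irreducible_in X A) \<and> (\<forall>x \<in> topspace X. {x} \<in> H X)) \<and>
     (\<forall>X Y f. t0_space X \<and> t0_space Y \<and> continuous_map X Y f \<longrightarrow>
        (\<forall>A \<in> H X. f ` A \<in> H Y))"

text \<open>
  The Smyth power space of a space over \<open>'u\<close> has its points in \<open>'u set\<close>.  To evaluate \<open>H\<close> at a
  space \<open>X\<close> over another type, one transports along a homeomorphism from a space
  over \<open>'u\<close> onto \<open>X\<close>.  By functoriality the result does not depend on the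
  homeomorphism (lemma \<open>H_at_homeomorphic\<close>), and it is \<open>H X\<close> again if \<open>X\<close>
  is itself over \<open>'u\<close> (lemma \<open>H_at_same\<close>).  A homeomorphic copy over \<open>'u\<close>
  exists iff \<open>X\<close> has at most as many points as \<open>'u\<close> (lemma \<open>has_copy_iff_lepoll\<close>).
  Pitfall: if there is none, then \<open>H_at H X\<close> is empty, so it is meaningful only for
  spaces with \<open>topspace X \<lesssim> (UNIV :: 'u set)\<close>.
\<close>

definition H_at :: "('u topology \<Rightarrow> 'u set set) \<Rightarrow> 'a topology \<Rightarrow> 'a set set" where
  "H_at H X = {f ` B | f Y B. homeomorphic_map Y X f \<and> B \<in> H Y}"

lemma H_at_homeomorphic:
  fixes H :: "'u topology \<Rightarrow> 'u set set" and X :: "'a topology"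
  assumes H: "R_subset_system H" and X: "t0_space X" and f: "homeomorphic_map Y X f"
  shows "H_at H X = (`) f ` H Y"
proof
  show "(`) f ` H Y \<subseteq> H_at H X"
    using f by (auto simp: H_at_def)
  show "H_at H X \<subseteq> (`) f ` H Y"
  proof
    fix A assume "A \<in> H_at H X"
    then obtain g Z B where g: "homeomorphic_map Z X g" and B: "B \<in> H Z" and A: "A = g ` B"
      by (auto simp: H_at_def)
    obtain f' where f': "homeomorphic_maps Y X f f'"
      using f homeomorphic_map_maps by blast
    have "t0_space Y" "t0_space Z"
      using X f g homeomorphic_t0_space homeomorphic_map_imp_homeomorphic_space by blast+
    moreover have "continuous_map Z Y (f' \<circ> g)"
      using f' unfolding homeomorphic_maps_def
      by (intro continuous_map_compose [OF homeomorphic_imp_continuous_map [OF g]]) simp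
    ultimately have *: "(f' \<circ> g) ` B \<in> H Y"
      using H B unfolding R_subset_system_def by blast
    have "B \<subseteq> topspace Z"
      using H B \<open>t0_space Z\<close> unfolding R_subset_system_def irreducible_in_def by blast
    then have "g ` B \<subseteq> topspace X"
      using g homeomorphic_imp_surjective_map by blast
    then have "f ` (f' ` g ` B) = g ` B"
      using f' by (force simp: homeomorphic_maps_def image_iff)
    then have "A = f ` ((f' \<circ> g) ` B)"
      by (simp add: A image_comp comp_assoc)
    then show "A \<in> (`) f ` H Y"
      using * by blast
  qed
qed

lemma H_at_same:
  fixes H :: "'u topology \<Rightarrow> 'u set set"
  assumes "R_subset_system H" "t0_space X"
  shows "H_at H X = H X"
  using H_at_homeomorphic [OF assms, of X id] by simp

lemma has_copy_iff_lepoll: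
  fixes X :: "'a topology"
  shows "(\<exists>(Y :: 'u topology) f. homeomorphic_map Y X f) \<longleftrightarrow> topspace X \<lesssim> (UNIV :: 'u set)"
proof
  assume "\<exists>(Y :: 'u topology) f. homeomorphic_map Y X f"
  then obtain Y :: "'u topology" and f where f: "homeomorphic_map Y X f"
    by blast
  then have "topspace X \<lesssim> topspace Y"
    by (metis homeomorphic_imp_surjective_map image_lepoll)
  then show "topspace X \<lesssim> (UNIV :: 'u set)"
    by (meson lepoll_trans subset_UNIV subset_imp_lepoll)
next
  assume "topspace X \<lesssim> (UNIV :: 'u set)"
  then obtain g :: "'a \<Rightarrow> 'u" where g: "inj_on g (topspace X)"
    by (auto simp: lepoll_def)
  define f where "f = inv_into (topspace X) g"
  define Y where "Y = pullback_topology (g ` topspace X) f X"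
  have fg: "f (g x) = x" if "x \<in> topspace X" for x
    using that g by (simp add: f_def)
  have top: "topspace Y = g ` topspace X"
    by (auto simp: Y_def topspace_pullback_topology fg)
  have "continuous_map Y X f"
    unfolding Y_def using continuous_map_pullback [OF continuous_map_id] by simp
  moreover have "continuous_map X Y g"
    unfolding Y_def
  proof (rule continuous_map_pullback')
    show "continuous_map X X (f \<circ> g)"
      by (rule continuous_map_eq [OF continuous_map_id]) (simp add: fg)
  qed auto
  ultimately have "homeomorphic_maps Y X f g"
    by (auto simp: homeomorphic_maps_def top fg)
  then show "\<exists>(Y :: 'u topology) f. homeomorphic_map Y X f"
    using homeomorphic_map_maps by blast
qed


section \<open>Sobriety and property M\<close>

definition H_sober :: "('u topology \<Rightarrow> 'u set set) \<Rightarrow> 'a topology \<Rightarrow> bool" where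
  "H_sober H X \<longleftrightarrow>
     t0_space X \<and>
     (\<forall>A \<in> H_at H X. \<exists>x \<in> topspace X. X closure_of A = X closure_of {x})"

definition super_H_sober :: "('u topology \<Rightarrow> 'u set set) \<Rightarrow> 'a topology \<Rightarrow> bool" where
  "super_H_sober H X \<longleftrightarrow> t0_space X \<and> H_sober H (smyth X)"

text \<open>
  \<open>X\<close> ranges over all \<open>T\<^sub>0\<close> spaces over \<open>'u\<close>; the condition is void for those whose Smyth
  power space has no copy over \<open>'u\<close>.
\<close>

definition property_M :: "('u topology \<Rightarrow> 'u set set) \<Rightarrow> bool" where
  "property_M H \<longleftrightarrow>
     (\<forall>X :: 'u topology. t0_space X \<longrightarrow>
        (\<forall>\<K> \<in> H_at H (smyth X). \<forall>A. closedin X A \<and> (\<forall>K \<in> \<K>. K \<inter> A \<noteq> {}) \<longrightarrow>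
           {up_closure X (K \<inter> A) | K. K \<in> \<K>} \<in> H_at H (smyth X)))"

text \<open>A bound on the number of points of \<open>smyth (smyth X)\<close> therefore bounds \<open>X\<close> and
  \<open>smyth X\<close> as well.\<close>

lemma topspace_lepoll_smyth:
  assumes X: "t0_space X"
  shows "topspace X \<lesssim> topspace (smyth X)"
proof -
  define h where "h x = topspace X \<inter> \<Inter>{U. openin X U \<and> x \<in> U}" for x
  have "h x \<in> compact_saturated X" if x: "x \<in> topspace X" for x
  proof -
    have "compactin X (h x)"
      unfolding compactin_def
    proof (intro conjI allI impI)
      show "h x \<subseteq> topspace X" by (auto simp: h_def)
      fix \<U> assume \<U>: "Ball \<U> (openin X) \<and> h x \<subseteq> \<Union>\<U>"
      have "x \<in> h x" using x by (auto simp: h_def)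
      then obtain U where "U \<in> \<U>" "x \<in> U" using \<U> by blast
      then have "h x \<subseteq> \<Union>{U}" using \<U> by (auto simp: h_def)
      then show "\<exists>\<F>. finite \<F> \<and> \<F> \<subseteq> \<U> \<and> h x \<subseteq> \<Union>\<F>"
        using \<open>U \<in> \<U>\<close> by (intro exI [of _ "{U}"]) auto
    qed
    moreover have "saturated_in X (h x)"
      unfolding saturated_in_def h_def by (rule exI [of _ "{U. openin X U \<and> x \<in> U}"]) auto
    moreover have "x \<in> h x" using x by (auto simp: h_def)
    ultimately show ?thesis by (auto simp: compact_saturated_def)
  qed
  moreover have "inj_on h (topspace X)"
  proof (rule inj_onI, rule ccontr)
    fix x y assume x: "x \<in> topspace X" and y: "y \<in> topspace X" and eq: "h x = h y" and "x \<noteq> y"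
    then obtain U where "openin X U" "(x \<in> U) \<noteq> (y \<in> U)"
      using X unfolding t0_space_def by metis
    moreover have "x \<in> h y" "y \<in> h x"
      using eq x y by (auto simp: h_def)
    ultimately show False
      by (auto simp: h_def)
  qed
  ultimately show ?thesis
    unfolding lepoll_def topspace_smyth by blast
qed

end

theory Submission
  imports Defs
begin

text \<open>
  Write \<open>P\<close> for the Smyth power space of \<open>X\<close> and \<open>PP\<close> for that of \<open>P\<close>.  Sobriety of a Smyth power
  space says that every \<open>\<K> \<in> H P\<close> has a \<^emph>\<open>limit\<close>: a compact saturated \<open>K\<close> whose open neighbourhoods
  are exactly the open sets that contain some member of \<open>\<K>\<close> (\<open>super_H_sober_iff\<close>).

  From \<open>PP\<close> to \<open>P\<close>: the map \<open>x \<mapsto> \<up>x\<close> is continuous, so it sends \<open>A \<in> H Y\<close> to a family that has a limit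
  \<open>K\<close> if \<open>Y\<close> is super sober.  Then \<open>K\<close> meets the closure of \<open>A\<close>, and any point in both is generic for
  \<open>A\<close>.  So every super sober space is sober (\<open>super_H_sober_imp_H_sober\<close>); take \<open>Y = P\<close>.

  From \<open>P\<close> to \<open>PP\<close>: the limit of \<open>\<AA> \<in> H PP\<close> is \<open>\<Inter>\<AA>\<close>.  What has to be shown is that an open \<open>\<U>\<close> of \<open>P\<close>
  which contains no member of \<open>\<AA>\<close> does not contain \<open>\<Inter>\<AA>\<close> either; compactness and nonemptiness of
  \<open>\<Inter>\<AA>\<close> are consequences.  As the members of \<open>\<AA>\<close> are compact, \<open>\<U>\<close> can be enlarged to a maximal open
  \<open>\<V>\<close> containing no member of \<open>\<AA>\<close>
  (\<open>maximal_open_containing_no_compact\<close>); this is the argument of Rudin's lemma.  Let \<open>\<C>\<close> be the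
  complement of \<open>\<V>\<close>, a closed set that meets every member of \<open>\<AA>\<close>.  By property M and continuity of the
  union map \<open>PP \<rightarrow> P\<close>, the family of all \<open>\<Union>(\<A> \<inter> \<C>)\<close> with \<open>\<A> \<in> \<AA>\<close> belongs to \<open>H P\<close>, so it has a
  limit \<open>K\<close>.  Because \<open>\<C>\<close> is closed, \<open>K \<in> \<C>\<close>.  Each point \<open>k\<close> of \<open>K\<close> lies, for every \<open>\<A> \<in> \<AA>\<close>, in a
  member of \<open>\<A> \<inter> \<C>\<close>, so maximality of \<open>\<V>\<close> forces \<open>k\<close> to lie in all members of \<open>\<C>\<close>.  Hence \<open>K\<close> is a
  subset of some member of \<open>\<A>\<close>, and therefore belongs to the saturated set \<open>\<A>\<close>, for every \<open>\<A> \<in> \<AA>\<close>.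
  So \<open>K \<in> \<Inter>\<AA> - \<U>\<close> (\<open>Inter_subset_open_imp_member_subset\<close>).
\<close>

section \<open>Specialization order and saturation\<close>

lemma spec_le_iff_open:
  "spec_le X x y \<longleftrightarrow>
     x \<in> topspace X \<and> y \<in> topspace X \<and> (\<forall>U. openin X U \<and> x \<in> U \<longrightarrow> y \<in> U)"
  by (auto simp: spec_le_def in_closure_of)

lemma spec_le_refl: "x \<in> topspace X \<Longrightarrow> spec_le X x x"
  by (simp add: spec_le_iff_open)

lemma spec_le_continuous_map:
  assumes "continuous_map X Y f" "spec_le X x y"
  shows "spec_le Y (f x) (f y)"
  unfolding spec_le_iff_open
proof (intro conjI allI impI)
  show "f x \<in> topspace Y" "f y \<in> topspace Y"
    using assms by (auto simp: spec_le_def continuous_map_def)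
  fix U assume U: "openin Y U \<and> f x \<in> U"
  then have "openin X {z \<in> topspace X. f z \<in> U}"
    using assms(1) by (simp add: continuous_map_def)
  then show "f y \<in> U"
    using assms(2) U unfolding spec_le_iff_open by blast
qed

lemma saturated_in_iff_upper:
  "saturated_in X A \<longleftrightarrow> A \<subseteq> topspace X \<and> (\<forall>x\<in>A. \<forall>y. spec_le X x y \<longrightarrow> y \<in> A)"
proof
  assume "saturated_in X A"
  then show "A \<subseteq> topspace X \<and> (\<forall>x\<in>A. \<forall>y. spec_le X x y \<longrightarrow> y \<in> A)"
    unfolding saturated_in_def spec_le_iff_open by blast
next
  assume A: "A \<subseteq> topspace X \<and> (\<forall>x\<in>A. \<forall>y. spec_le X x y \<longrightarrow> y \<in> A)"
  \<comment> \<open>An upper set is the intersection of the complements of the principal lower sets it misses.\<close>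
  let ?\<U> = "(\<lambda>z. topspace X - X closure_of {z}) ` (topspace X - A)"
  have "A = topspace X \<inter> \<Inter>?\<U>"
  proof
    show "A \<subseteq> topspace X \<inter> \<Inter>?\<U>"
      using A by (auto simp: spec_le_def)
    show "topspace X \<inter> \<Inter>?\<U> \<subseteq> A"
      by (auto simp: in_closure_of)
  qed
  moreover have "\<forall>U\<in>?\<U>. openin X U"
    by auto
  ultimately show "saturated_in X A"
    unfolding saturated_in_def by blast
qed

lemma subset_up_closure: "A \<subseteq> topspace X \<Longrightarrow> A \<subseteq> up_closure X A"
  by (auto simp: up_closure_def intro!: spec_le_refl)

lemma up_closure_subset_open_iff:
  assumes "A \<subseteq> topspace X" "openin X U"
  shows "up_closure X A \<subseteq> U \<longleftrightarrow> A \<subseteq> U"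
proof
  assume "up_closure X A \<subseteq> U"
  then show "A \<subseteq> U"
    using subset_up_closure [OF assms(1)] by blast
next
  assume "A \<subseteq> U"
  then show "up_closure X A \<subseteq> U"
    using assms(2) unfolding up_closure_def spec_le_iff_open by blast
qed

lemma up_closure_compact_saturated:
  assumes "compactin X A" "A \<noteq> {}"
  shows "up_closure X A \<in> compact_saturated X"
proof -
  have A: "A \<subseteq> topspace X"
    using assms(1) compactin_subset_topspace by blast
  have "compactin X (up_closure X A)"
    unfolding compactin_def
  proof (intro conjI allI impI)
    show "up_closure X A \<subseteq> topspace X"
      by (auto simp: up_closure_def spec_le_def)
    fix \<U> assume \<U>: "Ball \<U> (openin X) \<and> up_closure X A \<subseteq> \<Union>\<U>"
    then have "A \<subseteq> \<Union>\<U>"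
      using subset_up_closure [OF A] by blast
    then obtain \<F> where \<F>: "finite \<F>" "\<F> \<subseteq> \<U>" "A \<subseteq> \<Union>\<F>"
      using assms(1) \<U> unfolding compactin_def by meson
    then have "openin X (\<Union>\<F>)"
      using \<U> by blast
    then have "up_closure X A \<subseteq> \<Union>\<F>"
      using \<F> up_closure_subset_open_iff [OF A] by blast
    then show "\<exists>\<F>. finite \<F> \<and> \<F> \<subseteq> \<U> \<and> up_closure X A \<subseteq> \<Union>\<F>"
      using \<F> by blast
  qed
  moreover have "saturated_in X (up_closure X A)"
    unfolding saturated_in_iff_upper up_closure_def spec_le_iff_open by blast
  ultimately show ?thesis
    using assms subset_up_closure [OF A] by (auto simp: compact_saturated_def)
qed

lemma compact_saturated_subset_topspace: "K \<in> compact_saturated X \<Longrightarrow> K \<subseteq> topspace X"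
  by (auto simp: compact_saturated_def saturated_in_def)

lemma compact_saturated_upper:
  "K \<in> compact_saturated X \<Longrightarrow> x \<in> K \<Longrightarrow> spec_le X x y \<Longrightarrow> y \<in> K"
  by (auto simp: compact_saturated_def saturated_in_iff_upper)

lemma subset_compact_saturated_iff:
  assumes "K \<in> compact_saturated X" "L \<subseteq> topspace X"
  shows "L \<subseteq> K \<longleftrightarrow> (\<forall>U. openin X U \<and> K \<subseteq> U \<longrightarrow> L \<subseteq> U)"
proof
  assume R: "\<forall>U. openin X U \<and> K \<subseteq> U \<longrightarrow> L \<subseteq> U"
  obtain \<U> where "\<forall>U\<in>\<U>. openin X U" "K = topspace X \<inter> \<Inter>\<U>"
    using assms(1) by (auto simp: compact_saturated_def saturated_in_def)
  then show "L \<subseteq> K"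
    using R assms(2) by blast
qed blast

lemma up_closure_homeomorphic_image:
  assumes fg: "homeomorphic_maps X Y f g" and A: "A \<subseteq> topspace X"
  shows "up_closure Y (f ` A) = f ` up_closure X A"
proof -
  have f: "continuous_map X Y f" and g: "continuous_map Y X g"
    and gf: "\<And>x. x \<in> topspace X \<Longrightarrow> g (f x) = x" and fg': "\<And>y. y \<in> topspace Y \<Longrightarrow> f (g y) = y"
    using fg by (auto simp: homeomorphic_maps_def)
  show ?thesis
  proof
    show "f ` up_closure X A \<subseteq> up_closure Y (f ` A)"
      using spec_le_continuous_map [OF f] by (fastforce simp: up_closure_def)
    show "up_closure Y (f ` A) \<subseteq> f ` up_closure X A"
    proof
      fix y assume "y \<in> up_closure Y (f ` A)"
      then obtain x where x: "x \<in> A" "spec_le Y (f x) y"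
        by (auto simp: up_closure_def)
      then have "spec_le X x (g y)"
        using spec_le_continuous_map [OF g x(2)] gf A by auto
      moreover have "f (g y) = y"
        using x fg' by (simp add: spec_le_def)
      ultimately show "y \<in> f ` up_closure X A"
        using x by (force simp: up_closure_def image_iff)
    qed
  qed
qed


section \<open>Topology of the Smyth power space\<close>

lemma openin_smyth_iff:
  "openin (smyth X) \<W> \<longleftrightarrow>
     \<W> \<subseteq> compact_saturated X \<and>
     (\<forall>K\<in>\<W>. \<exists>U. openin X U \<and> K \<subseteq> U \<and> smyth_box X U \<subseteq> \<W>)"
proof
  assume W: "openin (smyth X) \<W>"
  then have "\<W> \<subseteq> compact_saturated X"
    using openin_subset topspace_smyth by metis
  moreover have "\<exists>U. openin X U \<and> K \<subseteq> U \<and> smyth_box X U \<subseteq> \<W>" if K: "K \<in> \<W>" for K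
  proof -
    obtain \<B> where \<B>: "\<forall>B\<in>\<B>. \<exists>U. openin X U \<and> B = smyth_box X U" "\<Union>\<B> = \<W>"
      using W unfolding openin_smyth union_of_def arbitrary_def by auto
    then obtain B where B: "B \<in> \<B>" "K \<in> B"
      using K by blast
    then obtain U where "openin X U" "B = smyth_box X U"
      using \<B>(1) by blast
    moreover have "B \<subseteq> \<W>"
      using B(1) \<B>(2) by (metis Union_upper)
    ultimately show ?thesis
      using B(2) by (intro exI [of _ U]) (simp add: smyth_box_def)
  qed
  ultimately show "\<W> \<subseteq> compact_saturated X \<and>
      (\<forall>K\<in>\<W>. \<exists>U. openin X U \<and> K \<subseteq> U \<and> smyth_box X U \<subseteq> \<W>)"
    by blast
next
  assume R: "\<W> \<subseteq> compact_saturated X \<and>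
      (\<forall>K\<in>\<W>. \<exists>U. openin X U \<and> K \<subseteq> U \<and> smyth_box X U \<subseteq> \<W>)"
  show "openin (smyth X) \<W>"
  proof (subst openin_subopen, intro ballI)
    fix K assume K: "K \<in> \<W>"
    then obtain U where U: "openin X U" "K \<subseteq> U" "smyth_box X U \<subseteq> \<W>"
      using R by blast
    moreover have "K \<in> smyth_box X U"
      using K U R by (auto simp: smyth_box_def)
    ultimately show "\<exists>T. openin (smyth X) T \<and> K \<in> T \<and> T \<subseteq> \<W>"
      using openin_smyth_box by blast
  qed
qed

lemma spec_le_smyth_iff:
  "spec_le (smyth X) K L \<longleftrightarrow> K \<in> compact_saturated X \<and> L \<in> compact_saturated X \<and> L \<subseteq> K"
proof -
  have "(\<forall>\<W>. openin (smyth X) \<W> \<and> K \<in> \<W> \<longrightarrow> L \<in> \<W>) \<longleftrightarrow> L \<subseteq> K"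
    if K: "K \<in> compact_saturated X" and L: "L \<in> compact_saturated X"
  proof
    assume R: "\<forall>\<W>. openin (smyth X) \<W> \<and> K \<in> \<W> \<longrightarrow> L \<in> \<W>"
    have "L \<subseteq> U" if "openin X U" "K \<subseteq> U" for U
      using R openin_smyth_box [OF that(1)] that(2) K by (auto simp: smyth_box_def)
    then show "L \<subseteq> K"
      using subset_compact_saturated_iff [OF K compact_saturated_subset_topspace [OF L]] by blast
  next
    assume "L \<subseteq> K"
    show "\<forall>\<W>. openin (smyth X) \<W> \<and> K \<in> \<W> \<longrightarrow> L \<in> \<W>"
    proof (intro allI impI)
      fix \<W> assume "openin (smyth X) \<W> \<and> K \<in> \<W>"
      then obtain U where "openin X U" "K \<subseteq> U" "smyth_box X U \<subseteq> \<W>"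
        unfolding openin_smyth_iff by blast
      moreover from this have "L \<in> smyth_box X U"
        using L \<open>L \<subseteq> K\<close> by (auto simp: smyth_box_def)
      ultimately show "L \<in> \<W>"
        by blast
    qed
  qed
  then show ?thesis
    unfolding spec_le_iff_open topspace_smyth by blast
qed

lemma continuous_map_into_smyth:
  assumes "\<And>x. x \<in> topspace X \<Longrightarrow> f x \<in> compact_saturated Y"
    and box: "\<And>U. openin Y U \<Longrightarrow> openin X {x \<in> topspace X. f x \<subseteq> U}"
  shows "continuous_map X (smyth Y) f"
  unfolding continuous_map_def
proof (intro conjI allI impI)
  show "f \<in> topspace X \<rightarrow> topspace (smyth Y)"
    using assms by (auto simp: topspace_smyth)
  fix \<W> assume W: "openin (smyth Y) \<W>"
  show "openin X {x \<in> topspace X. f x \<in> \<W>}"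
  proof (subst openin_subopen, intro ballI)
    fix x assume x: "x \<in> {x \<in> topspace X. f x \<in> \<W>}"
    then obtain U where U: "openin Y U" "f x \<subseteq> U" "smyth_box Y U \<subseteq> \<W>"
      using W unfolding openin_smyth_iff by blast
    show "\<exists>T. openin X T \<and> x \<in> T \<and> T \<subseteq> {x \<in> topspace X. f x \<in> \<W>}"
      using box [OF U(1)] U x assms(1)
      by (intro exI [of _ "{x \<in> topspace X. f x \<subseteq> U}"]) (auto simp: smyth_box_def)
  qed
qed

lemma continuous_map_principal_smyth:
  "continuous_map X (smyth X) (\<lambda>x. up_closure X {x})"
proof (rule continuous_map_into_smyth)
  fix U assume U: "openin X U"
  have "up_closure X {x} \<subseteq> U \<longleftrightarrow> x \<in> U" if "x \<in> topspace X" for x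
    using up_closure_subset_open_iff [of "{x}" X U] that U by simp
  then have "{x \<in> topspace X. up_closure X {x} \<subseteq> U} = U"
    using openin_subset [OF U] by blast
  then show "openin X {x \<in> topspace X. up_closure X {x} \<subseteq> U}"
    using U by simp
qed (simp add: up_closure_compact_saturated)

text \<open>
  An open cover of \<open>\<Union>\<A>\<close> has a finite subcover of each \<open>K \<in> \<A>\<close>; the boxes over the unions of such
  finite subfamilies cover the compact set \<open>\<A>\<close>, so finitely many of them do.
\<close>

lemma Union_compact_saturated:
  assumes A: "\<A> \<in> compact_saturated (smyth X)"
  shows "\<Union>\<A> \<in> compact_saturated X"
proof -
  have AK: "\<A> \<subseteq> compact_saturated X"
    using compact_saturated_subset_topspace [OF A] by (simp add: topspace_smyth)
  have top: "\<Union>\<A> \<subseteq> topspace X"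
    using AK compact_saturated_subset_topspace by blast
  have "compactin X (\<Union>\<A>)"
    unfolding compactin_def
  proof (intro conjI allI impI top)
    fix \<U> assume \<U>: "Ball \<U> (openin X) \<and> \<Union>\<A> \<subseteq> \<Union>\<U>"
    let ?\<F> = "{\<F>. finite \<F> \<and> \<F> \<subseteq> \<U>}"
    let ?box = "\<lambda>\<F>. smyth_box X (\<Union>\<F>)"
    have "\<A> \<subseteq> \<Union>(?box ` ?\<F>)"
    proof
      fix K assume K: "K \<in> \<A>"
      then have "compactin X K" "K \<subseteq> \<Union>\<U>"
        using AK \<U> by (auto simp: compact_saturated_def)
      then obtain \<F> where "finite \<F>" "\<F> \<subseteq> \<U>" "K \<subseteq> \<Union>\<F>"
        using \<U> unfolding compactin_def by meson
      then show "K \<in> \<Union>(?box ` ?\<F>)"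
        using K AK by (auto simp: smyth_box_def)
    qed
    moreover have "\<forall>B \<in> ?box ` ?\<F>. openin (smyth X) B"
      using \<U> by (auto intro!: openin_smyth_box openin_Union)
    moreover have "compactin (smyth X) \<A>"
      using A by (simp add: compact_saturated_def)
    ultimately obtain \<G> where \<G>: "finite \<G>" "\<G> \<subseteq> ?box ` ?\<F>" "\<A> \<subseteq> \<Union>\<G>"
      unfolding compactin_def by meson
    obtain \<H> where \<H>: "finite \<H>" "\<H> \<subseteq> ?\<F>" "\<G> = ?box ` \<H>"
      using finite_subset_image [OF \<G>(1,2)] by blast
    then have "finite (\<Union>\<H>)" "\<Union>\<H> \<subseteq> \<U>"
      by auto
    moreover have "K \<subseteq> \<Union>(\<Union>\<H>)" if K: "K \<in> \<A>" for K
    proof -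
      have "K \<in> \<Union>(?box ` \<H>)"
        using K \<G>(3) \<H>(3) by blast
      then obtain \<F> where "\<F> \<in> \<H>" "K \<subseteq> \<Union>\<F>"
        by (auto simp: smyth_box_def)
      then show ?thesis
        by blast
    qed
    then have "\<Union>\<A> \<subseteq> \<Union>(\<Union>\<H>)"
      by (rule Union_least)
    ultimately show "\<exists>\<F>. finite \<F> \<and> \<F> \<subseteq> \<U> \<and> \<Union>\<A> \<subseteq> \<Union>\<F>"
      by blast
  qed
  moreover have "saturated_in X (\<Union>\<A>)"
    unfolding saturated_in_iff_upper
  proof (intro conjI top ballI allI impI)
    fix x y assume "x \<in> \<Union>\<A>" "spec_le X x y"
    then obtain K where "K \<in> \<A>" "x \<in> K"
      by blast
    then show "y \<in> \<Union>\<A>"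
      using compact_saturated_upper [of K X x y] AK \<open>spec_le X x y\<close> by blast
  qed
  moreover have "\<Union>\<A> \<noteq> {}"
    using A AK by (fastforce simp: compact_saturated_def)
  ultimately show ?thesis
    by (simp add: compact_saturated_def)
qed

lemma continuous_map_Union_smyth: "continuous_map (smyth (smyth X)) (smyth X) \<Union>"
proof (rule continuous_map_into_smyth)
  fix U assume U: "openin X U"
  have "{\<A> \<in> topspace (smyth (smyth X)). \<Union>\<A> \<subseteq> U} = smyth_box (smyth X) (smyth_box X U)"
    using compact_saturated_subset_topspace [of _ "smyth X"]
    by (force simp: topspace_smyth smyth_box_def)
  then show "openin (smyth (smyth X)) {\<A> \<in> topspace (smyth (smyth X)). \<Union>\<A> \<subseteq> U}"
    using openin_smyth_box [OF openin_smyth_box [OF U]] by simp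
qed (simp add: topspace_smyth Union_compact_saturated)

lemma continuous_map_image_smyth:
  assumes fg: "homeomorphic_maps X Y f g"
  shows "continuous_map (smyth X) (smyth Y) ((`) f)"
proof (rule continuous_map_into_smyth)
  have f: "continuous_map X Y f"
    using fg by (simp add: homeomorphic_maps_def)
  fix K assume "K \<in> topspace (smyth X)"
  then have K: "K \<in> compact_saturated X"
    by (simp add: topspace_smyth)
  then have "up_closure X K = K"
    using subset_up_closure [OF compact_saturated_subset_topspace] compact_saturated_upper
    by (fastforce simp: up_closure_def)
  then have "f ` K = up_closure Y (f ` K)"
    using up_closure_homeomorphic_image [OF fg compact_saturated_subset_topspace [OF K]] by simp
  moreover have "compactin Y (f ` K)" "f ` K \<noteq> {}"
    using K image_compactin [OF _ f] by (auto simp: compact_saturated_def)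
  ultimately show "f ` K \<in> compact_saturated Y"
    using up_closure_compact_saturated by metis
next
  have f: "continuous_map X Y f"
    using fg by (simp add: homeomorphic_maps_def)
  fix U assume "openin Y U"
  then have "openin X {x \<in> topspace X. f x \<in> U}"
    using f by (simp add: continuous_map_def)
  moreover have "{K \<in> topspace (smyth X). f ` K \<subseteq> U} = smyth_box X {x \<in> topspace X. f x \<in> U}"
    using compact_saturated_subset_topspace [of _ X]
    by (auto simp: topspace_smyth smyth_box_def)
  ultimately show "openin (smyth X) {K \<in> topspace (smyth X). f ` K \<subseteq> U}"
    using openin_smyth_box by metis
qed

lemma homeomorphic_maps_smyth:
  assumes fg: "homeomorphic_maps X Y f g"
  shows "homeomorphic_maps (smyth X) (smyth Y) ((`) f) ((`) g)"
proof -
  have "g ` f ` K = K" if "K \<in> compact_saturated X" for K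
    using fg compact_saturated_subset_topspace [OF that]
    by (force simp: homeomorphic_maps_def image_iff)
  moreover have "f ` g ` K = K" if "K \<in> compact_saturated Y" for K
    using fg compact_saturated_subset_topspace [OF that]
    by (force simp: homeomorphic_maps_def image_iff)
  ultimately show ?thesis
    using continuous_map_image_smyth [OF fg]
      continuous_map_image_smyth [OF homeomorphic_maps_sym [THEN iffD1, OF fg]]
    by (simp add: homeomorphic_maps_def topspace_smyth)
qed


section \<open>Subset systems at spaces over other types\<close>

lemma H_at_subset_nonempty:
  fixes H :: "'u topology \<Rightarrow> 'u set set"
  assumes H: "R_subset_system H" and X: "t0_space X" and A: "A \<in> H_at H X"
  shows "A \<subseteq> topspace X" "A \<noteq> {}"
proof -
  obtain f Y B where f: "homeomorphic_map Y X f" and B: "B \<in> H Y" and AB: "A = f ` B"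
    using A by (auto simp: H_at_def)
  have "t0_space Y"
    using X f homeomorphic_t0_space homeomorphic_map_imp_homeomorphic_space by blast
  then have "B \<subseteq> topspace Y" "B \<noteq> {}"
    using H B unfolding R_subset_system_def irreducible_in_def by blast+
  then show "A \<subseteq> topspace X" "A \<noteq> {}"
    using f AB homeomorphic_imp_surjective_map by blast+
qed

text \<open>
  Functoriality for spaces over arbitrary types.  The size bound on the target provides the copy over
  \<open>'u\<close> through which the map is factored; without such a copy \<open>H_at H Y\<close> would be empty.
\<close>

lemma H_at_continuous_image:
  fixes H :: "'u topology \<Rightarrow> 'u set set"
  assumes H: "R_subset_system H" and X: "t0_space X" and Y: "t0_space Y"
    and f: "continuous_map X Y f" and A: "A \<in> H_at H X"
    and small: "topspace Y \<lesssim> (UNIV :: 'u set)"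
  shows "f ` A \<in> H_at H Y"
proof -
  obtain g Z B where g: "homeomorphic_map Z X g" and B: "B \<in> H Z" and AB: "A = g ` B"
    using A by (auto simp: H_at_def)
  obtain W :: "'u topology" and h where h: "homeomorphic_map W Y h"
    using small has_copy_iff_lepoll by blast
  obtain h' where h': "homeomorphic_maps W Y h h'"
    using h homeomorphic_map_maps by blast
  have "t0_space Z" "t0_space W"
    using X Y g h homeomorphic_t0_space homeomorphic_map_imp_homeomorphic_space by blast+
  moreover have "continuous_map Z W (h' \<circ> (f \<circ> g))"
    using h' unfolding homeomorphic_maps_def
    by (intro continuous_map_compose [OF continuous_map_compose
          [OF homeomorphic_imp_continuous_map [OF g] f]]) simp
  ultimately have "(h' \<circ> (f \<circ> g)) ` B \<in> H W"
    using H B unfolding R_subset_system_def by blast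
  moreover have "f ` A = h ` ((h' \<circ> (f \<circ> g)) ` B)"
  proof -
    have "f ` A \<subseteq> topspace Y"
      using H_at_subset_nonempty(1) [OF H X A] f by (auto simp: continuous_map_def)
    then have "h ` h' ` f ` A = f ` A"
      using h' by (force simp: homeomorphic_maps_def image_iff)
    then show ?thesis
      by (simp add: AB image_comp comp_assoc)
  qed
  ultimately show ?thesis
    using h unfolding H_at_def by blast
qed

text \<open>
  Property M speaks of spaces over \<open>'u\<close>, but it is needed at \<open>smyth X\<close>.  All its ingredients are
  topologically invariant, so it can be carried over from a homeomorphic copy.
\<close>

lemma property_M_at:
  fixes H :: "'u topology \<Rightarrow> 'u set set" and X :: "'a topology"
  assumes H: "R_subset_system H" and M: "property_M H" and X: "t0_space X"
    and small: "topspace (smyth X) \<lesssim> (UNIV :: 'u set)"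
    and \<K>: "\<K> \<in> H_at H (smyth X)" and A: "closedin X A" "\<And>K. K \<in> \<K> \<Longrightarrow> K \<inter> A \<noteq> {}"
  shows "(\<lambda>K. up_closure X (K \<inter> A)) ` \<K> \<in> H_at H (smyth X)"
proof -
  have "topspace X \<lesssim> (UNIV :: 'u set)"
    using topspace_lepoll_smyth [OF X] small lepoll_trans by blast
  then obtain Y :: "'u topology" and f where f: "homeomorphic_map Y X f"
    using has_copy_iff_lepoll by blast
  obtain g where fg: "homeomorphic_maps Y X f g"
    using f homeomorphic_map_maps by blast
  then have gf: "homeomorphic_maps X Y g f"
    using homeomorphic_maps_sym by blast
  have Y: "t0_space Y"
    using X f homeomorphic_t0_space homeomorphic_map_imp_homeomorphic_space by blast
  have "homeomorphic_map (smyth X) (smyth Y) ((`) g)"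
    using homeomorphic_maps_smyth [OF gf] homeomorphic_maps_map by blast
  then have "topspace (smyth Y) \<lesssim> topspace (smyth X)"
    by (metis homeomorphic_imp_surjective_map image_lepoll)
  then have smallY: "topspace (smyth Y) \<lesssim> (UNIV :: 'u set)"
    using small lepoll_trans by blast
  have \<K>Y: "(`) g ` \<K> \<in> H_at H (smyth Y)"
    using H_at_continuous_image [OF H t0_space_smyth t0_space_smyth
        continuous_map_image_smyth [OF gf] \<K> smallY] .
  have AY: "closedin Y (g ` A)"
    using A(1) gf homeomorphic_maps_map homeomorphic_map_closedness_eq by metis
  have meet: "K' \<inter> g ` A \<noteq> {}" if "K' \<in> (`) g ` \<K>" for K'
    using that A(2) by blast
  have "{up_closure Y (K' \<inter> g ` A) |K'. K' \<in> (`) g ` \<K>} \<in> H_at H (smyth Y)"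
    by (rule M [unfolded property_M_def, THEN spec, THEN mp, OF Y, THEN bspec, OF \<K>Y,
          THEN spec, THEN mp, OF conjI, OF AY ballI, OF meet])
  then have "(`) f ` {up_closure Y (K' \<inter> g ` A) |K'. K' \<in> (`) g ` \<K>} \<in> H_at H (smyth X)"
    by (rule H_at_continuous_image [OF H t0_space_smyth t0_space_smyth
        continuous_map_image_smyth [OF fg] _ small])
  moreover have "f ` up_closure Y (g ` K \<inter> g ` A) = up_closure X (K \<inter> A)" if "K \<in> \<K>" for K
  proof -
    have K: "K \<subseteq> topspace X"
      using that H_at_subset_nonempty(1) [OF H t0_space_smyth \<K>]
        compact_saturated_subset_topspace by (auto simp: topspace_smyth)
    have "inj_on g (topspace X)"
      using gf homeomorphic_imp_injective_map by (metis homeomorphic_maps_map)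
    then have "g ` K \<inter> g ` A = g ` (K \<inter> A)"
      by (simp add: inj_on_image_Int [OF _ K closedin_subset [OF A(1)]])
    moreover have "g ` (K \<inter> A) \<subseteq> topspace Y"
      using K gf by (auto simp: homeomorphic_maps_def continuous_map_def)
    moreover have "f ` g ` (K \<inter> A) = K \<inter> A"
    proof -
      have "f (g x) = x" if "x \<in> K \<inter> A" for x
        using fg that K by (auto simp: homeomorphic_maps_def)
      then have "(\<lambda>x. f (g x)) ` (K \<inter> A) = (\<lambda>x. x) ` (K \<inter> A)"
        by (intro image_cong refl)
      then show ?thesis
        by (simp add: image_image)
    qed
    ultimately show ?thesis
      by (simp add: up_closure_homeomorphic_image [OF fg, symmetric])
  qed
  ultimately show ?thesis
    by (simp add: Setcompr_eq_image image_image)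
qed


section \<open>Limits of families of compact saturated sets\<close>

definition smyth_limit :: "'a topology \<Rightarrow> 'a set set \<Rightarrow> 'a set \<Rightarrow> bool" where
  "smyth_limit X \<K> K \<longleftrightarrow>
     K \<in> compact_saturated X \<and> (\<forall>U. openin X U \<longrightarrow> (K \<subseteq> U \<longleftrightarrow> (\<exists>L\<in>\<K>. L \<subseteq> U)))"

lemma closure_of_eq_singleton_iff:
  assumes "A \<subseteq> topspace X" "x \<in> topspace X"
  shows "X closure_of A = X closure_of {x} \<longleftrightarrow> (\<forall>U. openin X U \<longrightarrow> (x \<in> U \<longleftrightarrow> A \<inter> U \<noteq> {}))"
proof
  assume eq: "X closure_of A = X closure_of {x}"
  show "\<forall>U. openin X U \<longrightarrow> (x \<in> U \<longleftrightarrow> A \<inter> U \<noteq> {})"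
    using openin_Int_closure_of_eq_empty [of X _ A] openin_Int_closure_of_eq_empty [of X _ "{x}"] eq
    by (auto simp: Int_commute)
next
  assume "\<forall>U. openin X U \<longrightarrow> (x \<in> U \<longleftrightarrow> A \<inter> U \<noteq> {})"
  then show "X closure_of A = X closure_of {x}"
    by (auto simp: closure_of_def)
qed

lemma smyth_closure_eq_iff_limit:
  assumes \<K>: "\<K> \<subseteq> compact_saturated X" and K: "K \<in> compact_saturated X"
  shows "smyth X closure_of \<K> = smyth X closure_of {K} \<longleftrightarrow> smyth_limit X \<K> K"
proof -
  have "(\<forall>\<W>. openin (smyth X) \<W> \<longrightarrow> (K \<in> \<W> \<longleftrightarrow> \<K> \<inter> \<W> \<noteq> {})) \<longleftrightarrow>
        (\<forall>U. openin X U \<longrightarrow> (K \<subseteq> U \<longleftrightarrow> (\<exists>L\<in>\<K>. L \<subseteq> U)))" (is "?all \<longleftrightarrow> ?boxes")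
  proof
    assume ?all
    show ?boxes
    proof (intro allI impI)
      fix U assume "openin X U"
      then have "K \<in> smyth_box X U \<longleftrightarrow> \<K> \<inter> smyth_box X U \<noteq> {}"
        using \<open>?all\<close> openin_smyth_box by blast
      then show "K \<subseteq> U \<longleftrightarrow> (\<exists>L\<in>\<K>. L \<subseteq> U)"
        using \<K> K by (auto simp: smyth_box_def)
    qed
  next
    assume ?boxes
    show ?all
    proof (intro allI impI)
      fix \<W> assume "openin (smyth X) \<W>"
      then have W: "\<And>L. L \<in> \<W> \<Longrightarrow> \<exists>U. openin X U \<and> L \<subseteq> U \<and> smyth_box X U \<subseteq> \<W>"
        by (simp add: openin_smyth_iff)
      show "K \<in> \<W> \<longleftrightarrow> \<K> \<inter> \<W> \<noteq> {}"
      proof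
        assume "K \<in> \<W>"
        then obtain U where "openin X U" "K \<subseteq> U" "smyth_box X U \<subseteq> \<W>"
          using W by blast
        moreover from this obtain L where "L \<in> \<K>" "L \<subseteq> U"
          using \<open>?boxes\<close> by blast
        ultimately show "\<K> \<inter> \<W> \<noteq> {}"
          using \<K> by (auto simp: smyth_box_def)
      next
        assume "\<K> \<inter> \<W> \<noteq> {}"
        then obtain L U where "L \<in> \<K>" "openin X U" "L \<subseteq> U" "smyth_box X U \<subseteq> \<W>"
          using W by blast
        then show "K \<in> \<W>"
          using \<open>?boxes\<close> K by (auto simp: smyth_box_def)
      qed
    qed
  qed
  then show ?thesis
    using closure_of_eq_singleton_iff [of \<K> "smyth X" K] \<K> K
    by (simp add: topspace_smyth smyth_limit_def)
qed

text \<open>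
  Two sets have the same closure iff they meet the same open sets, and in a Smyth power space it is
  enough to test this on boxes.
\<close>

lemma super_H_sober_iff:
  assumes H: "R_subset_system H"
  shows "super_H_sober H X \<longleftrightarrow>
    t0_space X \<and> (\<forall>\<K> \<in> H_at H (smyth X). \<exists>K. smyth_limit X \<K> K)"
proof -
  have "(\<exists>K \<in> topspace (smyth X). smyth X closure_of \<K> = smyth X closure_of {K}) \<longleftrightarrow>
        (\<exists>K. smyth_limit X \<K> K)" if "\<K> \<in> H_at H (smyth X)" for \<K>
    using smyth_closure_eq_iff_limit [of \<K> X]
      H_at_subset_nonempty(1) [OF H t0_space_smyth that]
    unfolding topspace_smyth by (metis smyth_limit_def)
  then show ?thesis
    by (simp add: super_H_sober_def H_sober_def t0_space_smyth)
qed


section \<open>Super sober spaces are sober\<close>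

lemma super_H_sober_imp_H_sober:
  fixes H :: "'u topology \<Rightarrow> 'u set set"
  assumes H: "R_subset_system H" and super: "super_H_sober H X"
    and small: "topspace (smyth X) \<lesssim> (UNIV :: 'u set)"
  shows "H_sober H X"
  unfolding H_sober_def
proof (intro conjI ballI)
  show X: "t0_space X"
    using super by (simp add: super_H_sober_def)
  fix A assume A: "A \<in> H_at H X"
  have Atop: "A \<subseteq> topspace X"
    using H_at_subset_nonempty(1) [OF H X A] .
  have "(\<lambda>x. up_closure X {x}) ` A \<in> H_at H (smyth X)"
    using H_at_continuous_image [OF H X t0_space_smyth continuous_map_principal_smyth A small] .
  then obtain K where K: "smyth_limit X ((\<lambda>x. up_closure X {x}) ` A) K"
    using super super_H_sober_iff [OF H] by blast
  have Kopen: "K \<subseteq> U \<longleftrightarrow> A \<inter> U \<noteq> {}" if U: "openin X U" for U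
  proof -
    have "K \<subseteq> U \<longleftrightarrow> (\<exists>x\<in>A. up_closure X {x} \<subseteq> U)"
      using K U by (simp add: smyth_limit_def)
    also have "\<dots> \<longleftrightarrow> (\<exists>x\<in>A. x \<in> U)"
    proof (rule bex_cong [OF refl])
      fix x assume "x \<in> A"
      then show "up_closure X {x} \<subseteq> U \<longleftrightarrow> x \<in> U"
        using up_closure_subset_open_iff [of "{x}" X U] U Atop by auto
    qed
    finally show ?thesis
      by blast
  qed
  \<comment> \<open>Otherwise the complement of the closure would be a neighbourhood of \<open>K\<close>, hence meet \<open>A\<close>.\<close>
  have "K \<inter> X closure_of A \<noteq> {}"
  proof
    assume "K \<inter> X closure_of A = {}"
    then have "K \<subseteq> topspace X - X closure_of A"
      using K compact_saturated_subset_topspace by (auto simp: smyth_limit_def)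
    then have "A \<inter> (topspace X - X closure_of A) \<noteq> {}"
      using Kopen [OF openin_diff [OF openin_topspace closedin_closure_of]] by simp
    then show False
      using closure_of_subset [OF Atop] by auto
  qed
  then obtain x where x: "x \<in> K" "x \<in> X closure_of A"
    by blast
  have "x \<in> U \<longleftrightarrow> A \<inter> U \<noteq> {}" if U: "openin X U" for U
    using Kopen [OF U] x U by (auto simp: in_closure_of)
  moreover have xtop: "x \<in> topspace X"
    using x by (simp add: in_closure_of)
  ultimately show "\<exists>x\<in>topspace X. X closure_of A = X closure_of {x}"
    using closure_of_eq_singleton_iff [OF Atop] by blast
qed


section \<open>Super sobriety passes to the Smyth power space\<close>

text \<open>
  If the union of a nonempty chain of open sets contains a compact set, so does a member of the chain.  The
  complement of the maximal open set is a minimal closed set meeting all members of \<open>\<K>\<close>.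
\<close>

lemma maximal_open_containing_no_compact:
  assumes cpt: "\<And>K. K \<in> \<K> \<Longrightarrow> compactin X K"
    and U: "openin X U" "\<And>K. K \<in> \<K> \<Longrightarrow> \<not> K \<subseteq> U"
  obtains V where "openin X V" "U \<subseteq> V" "\<And>K. K \<in> \<K> \<Longrightarrow> \<not> K \<subseteq> V"
    "\<And>W. openin X W \<Longrightarrow> V \<subset> W \<Longrightarrow> \<exists>K\<in>\<K>. K \<subseteq> W"
proof -
  let ?\<O> = "{V. openin X V \<and> U \<subseteq> V \<and> (\<forall>K\<in>\<K>. \<not> K \<subseteq> V)}"
  have "\<exists>V\<in>?\<O>. \<forall>W\<in>?\<O>. V \<subseteq> W \<longrightarrow> W = V"
  proof (rule subset_Zorn_nonempty)
    show "?\<O> \<noteq> {}"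
      using U by blast
    fix \<C> assume ne: "\<C> \<noteq> {}" and chain: "subset.chain ?\<O> \<C>"
    then have sub: "\<C> \<subseteq> ?\<O>"
      by (simp add: subset.chain_def)
    have "\<not> K \<subseteq> \<Union>\<C>" if K: "K \<in> \<K>" for K
    proof
      assume "K \<subseteq> \<Union>\<C>"
      moreover have "\<forall>C\<in>\<C>. openin X C"
        using sub by blast
      ultimately obtain \<F> where \<F>: "finite \<F>" "\<F> \<subseteq> \<C>" "K \<subseteq> \<Union>\<F>"
        using cpt [OF K] unfolding compactin_def by meson
      have "\<F> \<noteq> {}"
        using \<F>(3) U(2) [OF K] by auto
      moreover have "subset.chain \<F> \<F>"
        using chain \<F>(2) unfolding subset_chain_def by blast
      ultimately have "\<Union>\<F> \<in> \<F>"
        using Union_in_chain \<F>(1) by blast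
      then show False
        using \<F> sub K by blast
    qed
    then show "\<Union>\<C> \<in> ?\<O>"
      using sub ne by blast
  qed
  then obtain V where V: "V \<in> ?\<O>" "\<forall>W\<in>?\<O>. V \<subseteq> W \<longrightarrow> W = V"
    by blast
  have max: "\<exists>K\<in>\<K>. K \<subseteq> W" if "openin X W" "V \<subset> W" for W
  proof (rule ccontr)
    assume "\<not> (\<exists>K\<in>\<K>. K \<subseteq> W)"
    then have "W \<in> ?\<O>"
      using that V(1) by auto
    then show False
      using V(2) that(2) by auto
  qed
  show thesis
    by (rule that [of V]) (use V(1) max in auto)
qed

text \<open>A saturated set omits \<open>x\<close> iff it lies in the complement of the closure of \<open>{x}\<close>.\<close>

lemma openin_smyth_omitting_point:
  assumes x: "x \<in> topspace X"
  shows "openin (smyth X) {K \<in> compact_saturated X. x \<notin> K}"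
proof -
  have "{K \<in> compact_saturated X. x \<notin> K} = smyth_box X (topspace X - X closure_of {x})"
  proof -
    have "K \<inter> X closure_of {x} = {} \<longleftrightarrow> x \<notin> K" if K: "K \<in> compact_saturated X" for K
    proof -
      have "x \<in> X closure_of {x}"
        using x by (simp add: in_closure_of)
      moreover have "x \<in> K" if "y \<in> K" "y \<in> X closure_of {x}" for y
        using compact_saturated_upper [OF K that(1)] that(2) x
          closure_of_subset_topspace [of X] by (auto simp: spec_le_def)
      ultimately show ?thesis
        by blast
    qed
    then show ?thesis
      using compact_saturated_subset_topspace [of _ X] by (force simp: smyth_box_def)
  qed
  moreover have "openin X (topspace X - X closure_of {x})"
    by (simp add: openin_diff)
  ultimately show ?thesis
    by (simp only: openin_smyth_box)
qed

text \<open>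
  This generalizes the characterization of well-filtered spaces by filtered intersections of compact
  saturated sets, one level up.  The point of \<open>\<Inter>\<AA>\<close> outside \<open>\<U>\<close> is the limit \<open>K\<close> of the unions of
  the traces \<open>\<A> \<inter> \<C>\<close>, where \<open>\<C>\<close> is a minimal closed set disjoint from \<open>\<U>\<close> that meets all
  members of \<open>\<AA>\<close>.
\<close>

lemma Inter_subset_open_imp_member_subset:
  fixes H :: "'u topology \<Rightarrow> 'u set set" and X :: "'a topology"
  assumes H: "R_subset_system H" and M: "property_M H"
    and small: "topspace (smyth (smyth X)) \<lesssim> (UNIV :: 'u set)"
    and super: "super_H_sober H X"
    and \<AA>: "\<AA> \<in> H_at H (smyth (smyth X))"
    and \<U>: "openin (smyth X) \<U>" "\<Inter>\<AA> \<subseteq> \<U>"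
  shows "\<exists>\<A>\<in>\<AA>. \<A> \<subseteq> \<U>"
proof (rule ccontr)
  assume "\<not> (\<exists>\<A>\<in>\<AA>. \<A> \<subseteq> \<U>)"
  then have no: "\<And>\<A>. \<A> \<in> \<AA> \<Longrightarrow> \<not> \<A> \<subseteq> \<U>"
    by blast
  have smallX: "topspace (smyth X) \<lesssim> (UNIV :: 'u set)"
    using topspace_lepoll_smyth [OF t0_space_smyth] small lepoll_trans by blast
  have \<AA>sub: "\<AA> \<subseteq> compact_saturated (smyth X)"
    using H_at_subset_nonempty(1) [OF H t0_space_smyth \<AA>] by (simp add: topspace_smyth)
  then have \<AA>cs: "\<A> \<subseteq> compact_saturated X" if "\<A> \<in> \<AA>" for \<A>
    using that compact_saturated_subset_topspace [of \<A> "smyth X"] by (auto simp: topspace_smyth)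
  have "\<And>\<A>. \<A> \<in> \<AA> \<Longrightarrow> compactin (smyth X) \<A>"
    using \<AA>sub by (auto simp: compact_saturated_def)
  then obtain \<V> where \<V>: "openin (smyth X) \<V>" "\<U> \<subseteq> \<V>" "\<And>\<A>. \<A> \<in> \<AA> \<Longrightarrow> \<not> \<A> \<subseteq> \<V>"
    and max: "\<And>\<W>. openin (smyth X) \<W> \<Longrightarrow> \<V> \<subset> \<W> \<Longrightarrow> \<exists>\<A>\<in>\<AA>. \<A> \<subseteq> \<W>"
    using maximal_open_containing_no_compact [OF _ \<U>(1) no] by metis
  define \<C> where "\<C> = compact_saturated X - \<V>"
  have closed: "closedin (smyth X) \<C>"
    using \<V>(1) unfolding \<C>_def topspace_smyth [symmetric] by blast
  have meet: "\<A> \<inter> \<C> \<noteq> {}" if "\<A> \<in> \<AA>" for \<A>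
    using \<V>(3) [OF that] \<AA>cs [OF that] by (auto simp: \<C>_def)
  let ?up = "\<lambda>\<A>. up_closure (smyth X) (\<A> \<inter> \<C>)"
  \<comment> \<open>The order of \<open>smyth X\<close> is reverse inclusion, so closing upwards does not enlarge unions.\<close>
  have Union_up: "\<Union>(?up \<A>) = \<Union>(\<A> \<inter> \<C>)" if "\<A> \<in> \<AA>" for \<A>
  proof
    show "\<Union>(?up \<A>) \<subseteq> \<Union>(\<A> \<inter> \<C>)"
      by (auto simp: up_closure_def spec_le_smyth_iff)
    have "\<A> \<inter> \<C> \<subseteq> ?up \<A>"
      by (rule subset_up_closure) (auto simp: topspace_smyth \<C>_def)
    then show "\<Union>(\<A> \<inter> \<C>) \<subseteq> \<Union>(?up \<A>)"
      by blast
  qed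
  have up: "?up ` \<AA> \<in> H_at H (smyth (smyth X))"
    by (rule property_M_at [OF H M t0_space_smyth small \<AA> closed meet])
  have Union_cs: "\<Union>(\<A> \<inter> \<C>) \<in> compact_saturated X" if "\<A> \<in> \<AA>" for \<A>
  proof -
    have "?up \<A> \<in> compact_saturated (smyth X)"
      using that H_at_subset_nonempty(1) [OF H t0_space_smyth up] by (auto simp: topspace_smyth)
    then show ?thesis
      using Union_compact_saturated Union_up [OF that] by metis
  qed
  have "\<Union> ` ?up ` \<AA> \<in> H_at H (smyth X)"
    using H_at_continuous_image [OF H t0_space_smyth t0_space_smyth
        continuous_map_Union_smyth up smallX] .
  then obtain K where "smyth_limit X (\<Union> ` ?up ` \<AA>) K"
    using super super_H_sober_iff [OF H] by blast
  then have K: "K \<in> compact_saturated X"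
    and Klim: "\<And>U. openin X U \<Longrightarrow> K \<subseteq> U \<longleftrightarrow> (\<exists>\<A>\<in>\<AA>. \<Union>(\<A> \<inter> \<C>) \<subseteq> U)"
    by (simp_all add: smyth_limit_def Union_up)
  have KC: "K \<in> \<C>"
  proof (rule ccontr)
    assume "K \<notin> \<C>"
    then obtain U where U: "openin X U" "K \<subseteq> U" "smyth_box X U \<subseteq> \<V>"
      using K \<V>(1) unfolding \<C>_def openin_smyth_iff by blast
    then obtain \<A> where \<A>: "\<A> \<in> \<AA>" "\<Union>(\<A> \<inter> \<C>) \<subseteq> U"
      using Klim [OF U(1)] by auto
    obtain L where "L \<in> \<A> \<inter> \<C>"
      using meet [OF \<A>(1)] by blast
    then show False
      using U(3) \<A>(2) by (auto simp: smyth_box_def \<C>_def)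
  qed
  have K_le: "K \<subseteq> \<Union>(\<A> \<inter> \<C>)" if "\<A> \<in> \<AA>" for \<A>
  proof -
    have "K \<subseteq> U" if "openin X U" "\<Union>(\<A> \<inter> \<C>) \<subseteq> U" for U
      using Klim [OF that(1)] that(2) \<open>\<A> \<in> \<AA>\<close> by auto
    then show ?thesis
      using subset_compact_saturated_iff [OF Union_cs [OF that]
          compact_saturated_subset_topspace [OF K]] by blast
  qed
  \<comment> \<open>If \<open>L\<close> omitted a point of \<open>K\<close>, then \<open>\<V>\<close> could be enlarged by all sets omitting this point.\<close>
  have least: "K \<subseteq> L" if L: "L \<in> \<C>" for L
  proof (rule ccontr)
    assume "\<not> K \<subseteq> L"
    then obtain k where k: "k \<in> K" "k \<notin> L"
      by blast
    let ?\<W> = "\<V> \<union> {K \<in> compact_saturated X. k \<notin> K}"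
    have "k \<in> topspace X"
      using k K compact_saturated_subset_topspace by blast
    then have "openin (smyth X) ?\<W>"
      by (intro openin_Un \<V>(1) openin_smyth_omitting_point)
    moreover have "\<V> \<subset> ?\<W>"
      using k L by (auto simp: \<C>_def)
    ultimately obtain \<A> where "\<A> \<in> \<AA>" "\<A> \<subseteq> ?\<W>"
      using max by blast
    then show False
      using K_le k by (auto simp: \<C>_def)
  qed
  have "K \<in> \<A>" if \<A>: "\<A> \<in> \<AA>" for \<A>
  proof -
    obtain L where L: "L \<in> \<A>" "L \<in> \<C>"
      using meet [OF \<A>] by blast
    then have "spec_le (smyth X) L K"
      using least K by (simp add: spec_le_smyth_iff \<C>_def)
    then show ?thesis
      using compact_saturated_upper [of \<A> "smyth X" L K] L(1) \<AA>sub \<A> by blast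
  qed
  then have "K \<in> \<V>"
    using \<U>(2) \<V>(2) by blast
  then show False
    using KC by (simp add: \<C>_def)
qed

lemma super_H_sober_smyth:
  fixes H :: "'u topology \<Rightarrow> 'u set set" and X :: "'a topology"
  assumes H: "R_subset_system H" and M: "property_M H"
    and small: "topspace (smyth (smyth X)) \<lesssim> (UNIV :: 'u set)"
    and super: "super_H_sober H X"
  shows "super_H_sober H (smyth X)"
  unfolding super_H_sober_iff [OF H]
proof (intro conjI ballI t0_space_smyth)
  fix \<AA> assume \<AA>: "\<AA> \<in> H_at H (smyth (smyth X))"
  note member = Inter_subset_open_imp_member_subset [OF H M small super \<AA>]
  have \<AA>sub: "\<AA> \<subseteq> compact_saturated (smyth X)" and ne: "\<AA> \<noteq> {}"
    using H_at_subset_nonempty [OF H t0_space_smyth \<AA>] by (auto simp: topspace_smyth)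
  then obtain \<B> where \<B>: "\<B> \<in> \<AA>" "\<B> \<in> compact_saturated (smyth X)"
    by blast
  have "compactin (smyth X) (\<Inter>\<AA>)"
    unfolding compactin_def
  proof (intro conjI allI impI)
    show "\<Inter>\<AA> \<subseteq> topspace (smyth X)"
      using \<B> compact_saturated_subset_topspace by blast
    fix \<T> assume \<T>: "Ball \<T> (openin (smyth X)) \<and> \<Inter>\<AA> \<subseteq> \<Union>\<T>"
    then have "openin (smyth X) (\<Union>\<T>)"
      by blast
    then have "\<exists>\<A>\<in>\<AA>. \<A> \<subseteq> \<Union>\<T>"
      using \<T> by (intro member) simp_all
    then obtain \<A> where \<A>: "\<A> \<in> \<AA>" "\<A> \<subseteq> \<Union>\<T>"
      by (elim bexE)
    then have "compactin (smyth X) \<A>"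
      using \<AA>sub by (auto simp: compact_saturated_def)
    then obtain \<F> where "finite \<F>" "\<F> \<subseteq> \<T>" "\<A> \<subseteq> \<Union>\<F>"
      using \<A>(2) \<T> unfolding compactin_def by meson
    then show "\<exists>\<F>. finite \<F> \<and> \<F> \<subseteq> \<T> \<and> \<Inter>\<AA> \<subseteq> \<Union>\<F>"
      using \<A>(1) by blast
  qed
  moreover have "saturated_in (smyth X) (\<Inter>\<AA>)"
    unfolding saturated_in_iff_upper
  proof (intro conjI ballI allI impI InterI)
    show "\<Inter>\<AA> \<subseteq> topspace (smyth X)"
      using \<B> compact_saturated_subset_topspace by blast
    fix K L \<A> assume "K \<in> \<Inter>\<AA>" "spec_le (smyth X) K L" "\<A> \<in> \<AA>"
    then show "L \<in> \<A>"
      using compact_saturated_upper [of \<A> "smyth X" K L] \<AA>sub by blast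
  qed
  moreover have "\<Inter>\<AA> \<noteq> {}"
  proof
    assume "\<Inter>\<AA> = {}"
    then have "\<exists>\<A>\<in>\<AA>. \<A> \<subseteq> {}"
      by (intro member) simp_all
    then show False
      using \<AA>sub by (auto simp: compact_saturated_def)
  qed
  ultimately have "\<Inter>\<AA> \<in> compact_saturated (smyth X)"
    by (simp add: compact_saturated_def)
  then have "smyth_limit (smyth X) \<AA> (\<Inter>\<AA>)"
    using member unfolding smyth_limit_def by blast
  then show "\<exists>\<Q>. smyth_limit (smyth X) \<AA> \<Q>"
    by blast
qed

theorem theorem5p17:
  fixes H :: "'u topology \<Rightarrow> 'u set set" and X :: "'a topology"
  assumes "R_subset_system H"
    and "property_M H"
    and "t0_space X"
    and "topspace (smyth (smyth X)) \<lesssim> (UNIV :: 'u set)"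
  shows "super_H_sober H X \<longleftrightarrow> super_H_sober H (smyth X)"
proof
  assume "super_H_sober H X"
  then show "super_H_sober H (smyth X)"
    using super_H_sober_smyth assms by blast
next
  assume "super_H_sober H (smyth X)"
  then have "H_sober H (smyth X)"
    using super_H_sober_imp_H_sober assms by blast
  then show "super_H_sober H X"
    using assms(3) by (simp add: super_H_sober_def)
qed

end
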